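(* Let $q$ be a prime power, let $e_0=1$, and for $n\geq 1$ let $e_n$ be the number of $n\times n$ linear derangements over $\mathbf{F}_q$. Then for all $n \geq 1$, $$e_n = e_{n-1}(q^n-1)q^{n-1} + (-1)^n q^{n(n-1)/2}.$$
   Context: $\mathbf{F}_q$ is the field with $q$ elements. A square matrix over $\mathbf{F}_q$ is a linear derangement if it is invertible and fixes no non-zero vector (equivalently, neither $0$ nor $1$ is an eigenvalue). *)

theory Defs
  imports
    "HOL-Library.Cardinality"
    "HOL-Number_Theory.Prime_Powers"
    "Jordan_Normal_Form.Matrix"
begin

definition linear_derangement :: "'a::field mat \<Rightarrow> bool" where
  "linear_derangement A \<longleftrightarrow>
     invertible_mat A \<and> (\<forall>v \<in> carrier_vec (dim_col A). A *\<^sub>v v = v \<longrightarrow> v = 0\<^sub>v (dim_col A))"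

(* The type argument selects the finite field; the value at 0 is the convention e_0 = 1. *)
definition num_linear_derangements :: "'a::{finite, field} itself \<Rightarrow> nat \<Rightarrow> nat" where
  "num_linear_derangements _ n =
     (if n = 0 then 1 else card {A :: 'a mat. A \<in> carrier_mat n n \<and> linear_derangement A})"

end

theory Submission
  imports Defs "Jordan_Normal_Form.Determinant" "Berlekamp_Zassenhaus.Berlekamp_Type_Based"
begin

text \<open>
  For a square matrix \<open>A\<close> let \<open>N k A\<close> be the number of linearly independent \<open>k\<close>-tuples of vectors
  fixed by \<open>A\<close>. Two counts of such tuples determine the number of derangements.

  Choosing the vectors one at a time, each outside the span of its predecessors, gives
  \<open>N k A = (x - 1) (x - q) \<dots> (x - q\<^sup>k\<^sup>-\<^sup>1)\<close> where \<open>x\<close> is the number of vectors fixed by \<open>A\<close>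
  (lemma \<open>card_fixed_frames\<close>). For \<open>A = 1\<close> and \<open>k = n\<close> this is the order \<open>\<gamma> n\<close> of the general linear
  group. On the other hand, the group acts transitively on independent \<open>k\<close>-tuples for \<open>k \<le> n\<close>, so
  by orbit counting the sum of \<open>N k A\<close> over all invertible \<open>A\<close> is \<open>\<gamma> n\<close>, whatever the value of \<open>k\<close>
  (lemma \<open>sum_card_fixed_frames\<close>).

  With the weights \<open>c k = (-1)\<^sup>k q\<^bsup>k(k-1)/2\<^esup> / \<gamma> k\<close> the sum of \<open>c k * N k A\<close> over \<open>k \<le> n\<close> telescopes to
  a multiple of \<open>(x - q) (x - q\<^sup>2) \<dots> (x - q\<^sup>n)\<close>. It therefore vanishes if \<open>A\<close> fixes a non-zero vector,
  because then \<open>x\<close> is one of \<open>q, \<dots>, q\<^sup>n\<close>; and it is \<open>1\<close> if \<open>x = 1\<close>, since only \<open>k = 0\<close> contributes.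
  This is Moebius inversion on the lattice of subspaces, written in terms of tuples instead of
  subspaces. Summing over the invertible matrices gives
  \<open>e n = \<gamma> n (c 0 + \<dots> + c n)\<close> (lemma \<open>num_linear_derangements_eq_sum\<close>).

  The recurrence is now immediate: \<open>\<gamma> n = \<gamma> (n - 1) (q\<^sup>n - 1) q\<^sup>n\<^sup>-\<^sup>1\<close>, and the last summand contributes
  \<open>\<gamma> n * c n = (-1)\<^sup>n q\<^bsup>n(n-1)/2\<^esup>\<close>.

  An independent \<open>k\<close>-tuple in \<open>n\<close>-space is represented by the \<open>n \<times> k\<close> matrix \<open>P\<close> of full column rank
  having it as columns; \<open>A\<close> fixes the tuple iff \<open>A * P = P\<close>.
\<close>

section \<open>Falling q-factorials and the alternating weights\<close>

text \<open>If \<open>x\<close> is the number of vectors of a space over the field with \<open>q\<close> elements, this is the number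
  of linearly independent \<open>k\<close>-tuples in that space; at \<open>x = q\<^sup>k\<close> it is the order of the general
  linear group of degree \<open>k\<close>.\<close>
definition q_falling :: "real \<Rightarrow> real \<Rightarrow> nat \<Rightarrow> real" where
  "q_falling q x k = (\<Prod>i<k. x - q ^ i)"

text \<open>The Moebius function between nested subspaces of relative dimension \<open>k\<close> is the signed power of
  \<open>q\<close> in the numerator. The denominator is the number of ordered bases of a \<open>k\<close>-dimensional space, so
  weighting tuples instead of subspaces requires the quotient.\<close>
definition incl_excl_coeff :: "real \<Rightarrow> nat \<Rightarrow> real" where
  "incl_excl_coeff q k = (- 1) ^ k * q ^ (k * (k - 1) div 2) / q_falling q (q ^ k) k"

text \<open>Every factor but the first, \<open>q\<^sup>m\<^sup>+\<^sup>1 - 1\<close>, is \<open>q\<close> times a factor of the product for \<open>m\<close>.\<close>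
lemma q_falling_self_Suc:
  "q_falling q (q ^ Suc m) (Suc m) = (q ^ Suc m - 1) * q ^ m * q_falling q (q ^ m) m"
proof -
  have "q_falling q (q ^ Suc m) (Suc m) = (q ^ Suc m - 1) * (\<Prod>i<m. q * (q ^ m - q ^ i))"
    unfolding q_falling_def by (subst prod.lessThan_Suc_shift) (simp add: algebra_simps)
  also have "(\<Prod>i<m. q * (q ^ m - q ^ i)) = q ^ m * q_falling q (q ^ m) m"
    unfolding q_falling_def by (simp add: prod.distrib)
  finally show ?thesis by simp
qed

lemma q_falling_self_pos:
  assumes "q > 1"
  shows "q_falling q (q ^ k) k > 0"
  unfolding q_falling_def using assms by (auto intro!: prod_pos power_strict_increasing)

text \<open>For \<open>m > 0\<close> the partial sum is its last term with the factor \<open>x - 1\<close> replaced by \<open>x - q\<^sup>m\<close>.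
  Since \<open>c (m + 1) = - c m / (q\<^sup>m\<^sup>+\<^sup>1 - 1)\<close> for the weights \<open>c\<close>, the inductive step comes down to
  \<open>(x - 1) - (q\<^sup>m\<^sup>+\<^sup>1 - 1) = x - q\<^sup>m\<^sup>+\<^sup>1\<close>.\<close>
lemma sum_incl_excl_coeff:
  assumes q: "q > 1"
  shows "(\<Sum>k\<le>m. incl_excl_coeff q k * q_falling q x k) =
         incl_excl_coeff q m * (\<Prod>i<m. x - q ^ Suc i)"
proof (induction m)
  case 0
  then show ?case by (simp add: incl_excl_coeff_def q_falling_def)
next
  case (Suc m)
  define P where "P = (\<Prod>i<m. x - q ^ Suc i)"
  define g where "g = q_falling q (q ^ m) m"
  define Q where "Q = q ^ Suc m - 1"
  have g: "g > 0" unfolding g_def by (rule q_falling_self_pos[OF q])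
  have Q: "Q > 0" unfolding Q_def using one_less_power[OF q, of "Suc m"] by simp
  have tri: "Suc m * m div 2 = m * (m - 1) div 2 + m"
    by (cases m) (simp_all add: algebra_simps)
  have "q_falling q (q ^ Suc m) (Suc m) = Q * q ^ m * g"
    unfolding g_def Q_def by (rule q_falling_self_Suc)
  then have "incl_excl_coeff q (Suc m) =
      (- 1) ^ Suc m * q ^ (m * (m - 1) div 2 + m) / (Q * q ^ m * g)"
    unfolding incl_excl_coeff_def using tri by simp
  also have "\<dots> = - ((- 1) ^ m * q ^ (m * (m - 1) div 2) / g) / Q"
    using q by (simp add: power_add)
  finally have c: "incl_excl_coeff q (Suc m) = - incl_excl_coeff q m / Q"
    by (simp add: incl_excl_coeff_def g_def)
  have x: "q_falling q x (Suc m) = (x - 1) * P"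
    unfolding q_falling_def P_def by (subst prod.lessThan_Suc_shift) simp
  have "(\<Sum>k\<le>Suc m. incl_excl_coeff q k * q_falling q x k) =
        incl_excl_coeff q m * P + incl_excl_coeff q (Suc m) * ((x - 1) * P)"
    using Suc.IH by (simp add: x P_def)
  also have "\<dots> = incl_excl_coeff q (Suc m) * ((x - 1 - Q) * P)"
    unfolding c using Q by (simp add: field_simps)
  also have "(x - 1 - Q) * P = (\<Prod>i<Suc m. x - q ^ Suc i)"
    by (simp add: P_def Q_def)
  finally show ?case .
qed

section \<open>Independent tuples as matrices of full column rank\<close>

definition full_col_rank :: "'a::field mat \<Rightarrow> bool" where
  "full_col_rank P \<longleftrightarrow>
     (\<forall>x \<in> carrier_vec (dim_col P). P *\<^sub>v x = 0\<^sub>v (dim_row P) \<longrightarrow> x = 0\<^sub>v (dim_col P))"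

definition fixed_space :: "'a::field mat \<Rightarrow> 'a vec set" where
  "fixed_space A = {v \<in> carrier_vec (dim_row A). A *\<^sub>v v = v}"

text \<open>The columns of the members are the independent \<open>k\<close>-tuples of vectors fixed by \<open>A\<close>.\<close>
definition fixed_frames :: "'a::field mat \<Rightarrow> nat \<Rightarrow> 'a mat set" where
  "fixed_frames A k = {P \<in> carrier_mat (dim_row A) k. full_col_rank P \<and> A * P = P}"

definition first_cols :: "nat \<Rightarrow> 'a mat \<Rightarrow> 'a mat" where
  "first_cols k P = mat (dim_row P) k (\<lambda>(i, j). P $$ (i, j))"

definition append_col :: "'a mat \<Rightarrow> 'a vec \<Rightarrow> 'a mat" where
  "append_col P v = mat (dim_row P) (Suc (dim_col P))
     (\<lambda>(i, j). if j < dim_col P then P $$ (i, j) else v $ i)"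

lemma full_col_rankI:
  assumes "P \<in> carrier_mat n k"
    and "\<And>x. x \<in> carrier_vec k \<Longrightarrow> P *\<^sub>v x = 0\<^sub>v n \<Longrightarrow> x = 0\<^sub>v k"
  shows "full_col_rank P"
  using assms unfolding full_col_rank_def by simp

lemma full_col_rankD:
  assumes "P \<in> carrier_mat n k" "full_col_rank P" "x \<in> carrier_vec k" "P *\<^sub>v x = 0\<^sub>v n"
  shows "x = 0\<^sub>v k"
  using assms unfolding full_col_rank_def by simp

lemma finite_carrier_mat: "finite (carrier_mat n k :: 'a::finite mat set)"
proof (rule finite_subset)
  show "carrier_mat n k \<subseteq> mat n k ` (({..<n} \<times> {..<k}) \<rightarrow>\<^sub>E (UNIV :: 'a set))"
  proof
    fix P :: "'a mat" assume P: "P \<in> carrier_mat n k"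
    have "P = mat n k (restrict (($$) P) ({..<n} \<times> {..<k}))"
      using P by (intro eq_matI) auto
    then show "P \<in> mat n k ` (({..<n} \<times> {..<k}) \<rightarrow>\<^sub>E (UNIV :: 'a set))"
      by (rule image_eqI[OF _ restrict_PiE_iff[THEN iffD2]]) auto
  qed
qed (auto intro!: finite_imageI finite_PiE)

lemma append_col_carrier [simp]:
  "P \<in> carrier_mat n k \<Longrightarrow> append_col P v \<in> carrier_mat n (Suc k)"
  unfolding append_col_def by auto

lemma first_cols_carrier [simp]:
  "P \<in> carrier_mat n m \<Longrightarrow> first_cols k P \<in> carrier_mat n k"
  unfolding first_cols_def by auto

lemma append_col_mult_vec:
  fixes P :: "'a::field mat"
  assumes "P \<in> carrier_mat n k" "v \<in> carrier_vec n" "x \<in> carrier_vec k"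
  shows "append_col P v *\<^sub>v (x @\<^sub>v vec 1 (\<lambda>_. a)) = P *\<^sub>v x + a \<cdot>\<^sub>v v"
proof (rule eq_vecI)
  fix i assume i: "i < dim_vec (P *\<^sub>v x + a \<cdot>\<^sub>v v)"
  with assms show "(append_col P v *\<^sub>v (x @\<^sub>v vec 1 (\<lambda>_. a))) $ i = (P *\<^sub>v x + a \<cdot>\<^sub>v v) $ i"
    by (auto simp: append_col_def scalar_prod_def mult.commute intro!: sum.cong)
qed (use assms in \<open>auto simp: append_col_def\<close>)

lemma mult_append_col:
  fixes P :: "'a::field mat"
  assumes "A \<in> carrier_mat n n" "P \<in> carrier_mat n k" "v \<in> carrier_vec n"
  shows "A * append_col P v = append_col (A * P) (A *\<^sub>v v)"
  using assms
  by (intro eq_matI) (auto simp: append_col_def scalar_prod_def intro!: sum.cong)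

lemma mult_first_cols:
  fixes P :: "'a::field mat"
  assumes "A \<in> carrier_mat n n" "P \<in> carrier_mat n m" "k \<le> m"
  shows "first_cols k (A * P) = A * first_cols k P"
  using assms
  by (intro eq_matI) (auto simp: first_cols_def scalar_prod_def intro!: sum.cong)

lemma first_cols_append_col:
  assumes "P \<in> carrier_mat n k"
  shows "first_cols k (append_col P v) = P"
  using assms by (intro eq_matI) (auto simp: first_cols_def append_col_def)

lemma col_append_col:
  assumes "P \<in> carrier_mat n k" "v \<in> carrier_vec n"
  shows "col (append_col P v) k = v"
  using assms by (intro eq_vecI) (auto simp: append_col_def)

lemma append_col_first_cols:
  assumes "P \<in> carrier_mat n (Suc k)"
  shows "append_col (first_cols k P) (col P k) = P"
  using assms by (intro eq_matI) (auto simp: first_cols_def append_col_def less_Suc_eq)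

lemma first_cols_first_cols:
  assumes "k \<le> m"
  shows "first_cols k (first_cols m P) = first_cols k P"
  using assms by (intro eq_matI) (auto simp: first_cols_def)

lemma full_col_rank_inj_on:
  fixes P :: "'a::field mat"
  assumes P: "P \<in> carrier_mat n k" and rank: "full_col_rank P"
  shows "inj_on ((*\<^sub>v) P) (carrier_vec k)"
proof (rule inj_onI)
  fix x y assume x: "x \<in> carrier_vec k" and y: "y \<in> carrier_vec k" and eq: "P *\<^sub>v x = P *\<^sub>v y"
  have "P *\<^sub>v (x - y) = P *\<^sub>v x - P *\<^sub>v y"
    by (rule mult_minus_distrib_mat_vec[OF P x y])
  also have "\<dots> = 0\<^sub>v n" using eq P y by auto
  finally have 0: "x - y = 0\<^sub>v k"
    using rank P x y unfolding full_col_rank_def by auto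
  show "x = y"
  proof (rule eq_vecI)
    fix i assume "i < dim_vec y"
    with arg_cong[OF 0, of "\<lambda>u. u $ i"] x y show "x $ i = y $ i" by auto
  qed (use x y in auto)
qed

lemma card_range_full_col_rank:
  fixes P :: "'a::{finite, field} mat"
  assumes "P \<in> carrier_mat n k" "full_col_rank P"
  shows "card ((*\<^sub>v) P ` carrier_vec k) = CARD('a) ^ k"
  using card_image[OF full_col_rank_inj_on[OF assms]] by (simp add: card_carrier_vec)

text \<open>The extension step of a tuple. A kernel vector \<open>(x, a)\<close> of the larger matrix with \<open>a \<noteq> 0\<close>
  expresses \<open>v\<close> through the columns of \<open>P\<close>; one with \<open>a = 0\<close> is a kernel vector of \<open>P\<close>.\<close>
lemma full_col_rank_append_col_iff:
  fixes P :: "'a::field mat"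
  assumes P: "P \<in> carrier_mat n k" and v: "v \<in> carrier_vec n"
  shows "full_col_rank (append_col P v) \<longleftrightarrow>
         full_col_rank P \<and> v \<notin> (*\<^sub>v) P ` carrier_vec k"
proof -
  have zero: "0 \<cdot>\<^sub>v v = 0\<^sub>v n" using v by (intro eq_vecI) auto
  show ?thesis
  proof
    assume R: "full_col_rank (append_col P v)"
    have ker: "x = 0\<^sub>v k \<and> a = 0"
      if x: "x \<in> carrier_vec k" and 0: "P *\<^sub>v x + a \<cdot>\<^sub>v v = 0\<^sub>v n" for x a
    proof -
      have "append_col P v *\<^sub>v (x @\<^sub>v vec 1 (\<lambda>_. a)) = 0\<^sub>v n"
        using append_col_mult_vec[OF P v x, of a] unfolding 0 .
      moreover have "x @\<^sub>v vec 1 (\<lambda>_. a) \<in> carrier_vec (Suc k)"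
        using append_carrier_vec[OF x vec_carrier[of 1 "\<lambda>_. a"]] by simp
      ultimately have *: "x @\<^sub>v vec 1 (\<lambda>_. a) = 0\<^sub>v (Suc k)"
        by (rule full_col_rankD[OF append_col_carrier[OF P] R, rotated])
      have comp: "(x @\<^sub>v vec 1 (\<lambda>_. a)) $ i = 0" if "i < Suc k" for i
        using * that by simp
      have "x $ i = 0" if "i < k" for i using comp[of i] that x by simp
      moreover have "a = 0" using comp[of k] x by simp
      ultimately show ?thesis using x by (intro conjI eq_vecI) auto
    qed
    show "full_col_rank P \<and> v \<notin> (*\<^sub>v) P ` carrier_vec k"
    proof
      have "x = 0\<^sub>v k" if "x \<in> carrier_vec k" "P *\<^sub>v x = 0\<^sub>v n" for x
        using ker[of x 0] that by (simp add: zero)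
      then show "full_col_rank P" by (rule full_col_rankI[OF P])
      show "v \<notin> (*\<^sub>v) P ` carrier_vec k"
      proof
        assume "v \<in> (*\<^sub>v) P ` carrier_vec k"
        then obtain x where x: "x \<in> carrier_vec k" "v = P *\<^sub>v x" by blast
        \<comment> \<open>a relation in which the new column has coefficient \<open>-1\<close>, against \<open>ker\<close>\<close>
        have "P *\<^sub>v x + (- 1) \<cdot>\<^sub>v v = 0\<^sub>v n" using v x(2)[symmetric] by (intro eq_vecI) auto
        from ker[OF x(1) this] show False by simp
      qed
    qed
  next
    assume R: "full_col_rank P \<and> v \<notin> (*\<^sub>v) P ` carrier_vec k"
    have "y = 0\<^sub>v (Suc k)"
      if y: "y \<in> carrier_vec (Suc k)" and y0: "append_col P v *\<^sub>v y = 0\<^sub>v n" for y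
    proof -
      define x where "x = vec_first y k"
      define a where "a = y $ k"
      have x: "x \<in> carrier_vec k" unfolding x_def by simp
      have yx: "y = x @\<^sub>v vec 1 (\<lambda>_. a)"
        unfolding x_def a_def vec_first_def using y by (intro eq_vecI) (auto simp: less_Suc_eq)
      have 0: "P *\<^sub>v x + a \<cdot>\<^sub>v v = 0\<^sub>v n"
        using append_col_mult_vec[OF P v x, of a] y0 unfolding yx by (rule trans[OF sym])
      have "a = 0"
      proof (rule ccontr)
        assume a: "a \<noteq> 0"
        have "v = (- inverse a) \<cdot>\<^sub>v (P *\<^sub>v x)"
        proof (rule eq_vecI)
          fix i assume i: "i < dim_vec (- inverse a \<cdot>\<^sub>v (P *\<^sub>v x))"
          then have i': "i < n" using P by simp
          have "(P *\<^sub>v x) $ i + a * v $ i = 0"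
            using arg_cong[OF 0, of "\<lambda>u. u $ i"] i' P v by auto
          then have "a * v $ i = - ((P *\<^sub>v x) $ i)" by (simp add: eq_neg_iff_add_eq_0 add.commute)
          then have "v $ i = - inverse a * (P *\<^sub>v x) $ i" using a by (simp add: field_simps)
          then show "v $ i = (- inverse a \<cdot>\<^sub>v (P *\<^sub>v x)) $ i" using i by simp
        qed (use P v in auto)
        also have "\<dots> = P *\<^sub>v ((- inverse a) \<cdot>\<^sub>v x)" by (rule mult_mat_vec[OF P x, symmetric])
        finally show False using R x by auto
      qed
      moreover have "x = 0\<^sub>v k"
        using 0 R P x \<open>a = 0\<close> by (auto simp: zero intro!: full_col_rankD[OF P])
      ultimately show ?thesis using yx by (intro eq_vecI) auto
    qed
    then show "full_col_rank (append_col P v)"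
      by (rule full_col_rankI[OF append_col_carrier[OF P]])
  qed
qed

section \<open>Counting the independent tuples fixed by a matrix\<close>

lemma bij_betw_append_col_fixed_frames:
  fixes A :: "'a::field mat"
  assumes A: "A \<in> carrier_mat n n"
  shows "bij_betw (\<lambda>(P, v). append_col P v)
           (SIGMA P : fixed_frames A k. fixed_space A - (*\<^sub>v) P ` carrier_vec k)
           (fixed_frames A (Suc k))"
proof (rule bij_betwI[where g = "\<lambda>P. (first_cols k P, col P k)"])
  show "(\<lambda>(P, v). append_col P v) \<in>
        (SIGMA P : fixed_frames A k. fixed_space A - (*\<^sub>v) P ` carrier_vec k) \<rightarrow> fixed_frames A (Suc k)"
    using A by (auto simp: fixed_frames_def fixed_space_def mult_append_col full_col_rank_append_col_iff)
  show "(\<lambda>P. (first_cols k P, col P k)) \<in> fixed_frames A (Suc k) \<rightarrow>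
        (SIGMA P : fixed_frames A k. fixed_space A - (*\<^sub>v) P ` carrier_vec k)"
  proof
    fix P assume "P \<in> fixed_frames A (Suc k)"
    then have P: "P \<in> carrier_mat n (Suc k)" and R: "full_col_rank P" and AP: "A * P = P"
      using A by (auto simp: fixed_frames_def)
    have c: "first_cols k P \<in> carrier_mat n k" "col P k \<in> carrier_vec n"
      using P by auto
    have "A * first_cols k P = first_cols k P"
      using mult_first_cols[OF A P, of k] AP by simp
    moreover have "A *\<^sub>v col P k = col P k"
      using col_mult2[OF A P, of k] AP by simp
    moreover have "full_col_rank (append_col (first_cols k P) (col P k))"
      using R append_col_first_cols[OF P] by simp
    ultimately show "(first_cols k P, col P k) \<in>
        (SIGMA P : fixed_frames A k. fixed_space A - (*\<^sub>v) P ` carrier_vec k)"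
      using c A full_col_rank_append_col_iff[OF c]
      by (simp add: fixed_frames_def fixed_space_def)
  qed
next
  fix x assume "x \<in> (SIGMA P : fixed_frames A k. fixed_space A - (*\<^sub>v) P ` carrier_vec k)"
  then obtain P v where "x = (P, v)" "P \<in> carrier_mat n k" "v \<in> carrier_vec n"
    using A by (auto simp: fixed_frames_def fixed_space_def)
  then show "(\<lambda>P. (first_cols k P, col P k)) (case x of (P, v) \<Rightarrow> append_col P v) = x"
    by (simp add: first_cols_append_col col_append_col)
next
  fix P assume "P \<in> fixed_frames A (Suc k)"
  then show "(case (first_cols k P, col P k) of (P, v) \<Rightarrow> append_col P v) = P"
    using A append_col_first_cols[of P n k] by (simp add: fixed_frames_def)
qed

text \<open>The span of a fixed tuple of length \<open>k\<close> lies in the fixed space and has \<open>q\<^sup>k\<close> elements, so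
  there are \<open>x - q\<^sup>k\<close> ways to append a further vector. Over the reals the formula also covers the
  \<open>k\<close> for which no such tuple exists, since then an earlier factor is zero.\<close>
lemma card_fixed_frames:
  fixes A :: "'a::{finite, field} mat"
  assumes A: "A \<in> carrier_mat n n"
  shows "real (card (fixed_frames A k)) = q_falling (real CARD('a)) (real (card (fixed_space A))) k"
proof (induction k)
  case 0
  have "fixed_frames A 0 = {mat n 0 (\<lambda>_. 0)}"
    using A by (auto simp: fixed_frames_def full_col_rank_def intro!: eq_matI eq_vecI)
  then show ?case by (simp add: q_falling_def)
next
  case (Suc k)
  have fin: "finite (fixed_frames A k)"
    by (rule finite_subset[OF _ finite_carrier_mat]) (auto simp: fixed_frames_def)
  have finv: "finite (fixed_space A)"
    by (rule finite_subset[OF _ finite_carrier_vec]) (auto simp: fixed_space_def)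
  have ext: "real (card (fixed_space A - (*\<^sub>v) P ` carrier_vec k)) =
             real (card (fixed_space A)) - real CARD('a) ^ k"
    if "P \<in> fixed_frames A k" for P
  proof -
    have P: "P \<in> carrier_mat n k" "full_col_rank P" "A * P = P"
      using that A by (auto simp: fixed_frames_def)
    have sub: "(*\<^sub>v) P ` carrier_vec k \<subseteq> fixed_space A"
    proof
      fix v assume "v \<in> (*\<^sub>v) P ` carrier_vec k"
      then obtain x where x: "x \<in> carrier_vec k" "v = P *\<^sub>v x" by blast
      have "A *\<^sub>v (P *\<^sub>v x) = (A * P) *\<^sub>v x"
        using assoc_mult_mat_vec[OF A P(1) x(1)] by simp
      then show "v \<in> fixed_space A"
        using P x A by (auto simp: fixed_space_def)
    qed
    then have "card ((*\<^sub>v) P ` carrier_vec k) \<le> card (fixed_space A)"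
      by (rule card_mono[OF finv])
    with sub show ?thesis
      using card_Diff_subset[OF finite_subset[OF sub finv] sub] card_range_full_col_rank[OF P(1,2)]
      by (simp add: of_nat_diff)
  qed
  have "card (fixed_frames A (Suc k)) =
        card (SIGMA P : fixed_frames A k. fixed_space A - (*\<^sub>v) P ` carrier_vec k)"
    using bij_betw_same_card[OF bij_betw_append_col_fixed_frames[OF A]] by simp
  also have "\<dots> = (\<Sum>P\<in>fixed_frames A k. card (fixed_space A - (*\<^sub>v) P ` carrier_vec k))"
    using fin finv by (intro card_SigmaI) auto
  finally have "real (card (fixed_frames A (Suc k))) =
      (\<Sum>P\<in>fixed_frames A k. real (card (fixed_space A)) - real CARD('a) ^ k)"
    using ext by simp
  then show ?case using Suc.IH by (simp add: q_falling_def)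
qed

lemma card_field_gt_1: "CARD('a::{finite, field}) > 1"
proof -
  have "card {0, 1 :: 'a} \<le> CARD('a)" by (intro card_mono) auto
  then show ?thesis by simp
qed

lemma full_col_rank_dim_le:
  fixes P :: "'a::{finite, field} mat"
  assumes P: "P \<in> carrier_mat n k" and R: "full_col_rank P"
  shows "k \<le> n"
proof -
  have "CARD('a) ^ k \<le> card (carrier_vec n :: 'a vec set)"
    unfolding card_range_full_col_rank[OF assms, symmetric]
    using P by (intro card_mono finite_carrier_vec) auto
  then have "CARD('a) ^ k \<le> CARD('a) ^ n" by (simp add: card_carrier_vec)
  then show ?thesis
    by (rule power_le_imp_le_exp[OF card_field_gt_1])
qed

text \<open>This bounds the dimension of the fixed space without speaking about bases: there are no
  \<open>n + 1\<close> independent vectors in \<open>n\<close>-space, hence the product that counts them has a zero factor.\<close>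
lemma card_fixed_space_power:
  fixes A :: "'a::{finite, field} mat"
  assumes A: "A \<in> carrier_mat n n"
  obtains i where "i \<le> n" "card (fixed_space A) = CARD('a) ^ i"
proof -
  have "fixed_frames A (Suc n) = {}"
    using A by (auto simp: fixed_frames_def dest: full_col_rank_dim_le)
  then have "q_falling (real CARD('a)) (real (card (fixed_space A))) (Suc n) = 0"
    using card_fixed_frames[OF A, of "Suc n"] by simp
  then obtain i where "i < Suc n" "real (card (fixed_space A)) = real CARD('a) ^ i"
    unfolding q_falling_def by (auto simp del: prod.lessThan_Suc of_nat_power
        of_nat_power_eq_of_nat_cancel_iff of_nat_eq_of_nat_power_cancel_iff)
  then show thesis using that[of i] by (metis less_Suc_eq_le of_nat_eq_iff of_nat_power)
qed

section \<open>Transitivity and orbit counting\<close>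

text \<open>This is the transitivity of the general linear group on independent \<open>k\<close>-tuples: every such tuple
  is the image under some \<open>g\<close> of the first \<open>k\<close> unit vectors. While \<open>k < n\<close>, the span is
  too small to be the whole space, so the tuple can be prolonged.\<close>
lemma full_col_rank_extend:
  fixes P :: "'a::{finite, field} mat"
  assumes "P \<in> carrier_mat n k" "full_col_rank P" "k \<le> n"
  shows "\<exists>g \<in> carrier_mat n n. full_col_rank g \<and> first_cols k g = P"
  using assms
proof (induction "n - k" arbitrary: k P)
  case 0
  then have "first_cols k P = P" by (intro eq_matI) (auto simp: first_cols_def)
  with 0 show ?case by auto
next
  case (Suc d)
  note P = Suc.prems(1,2)
  have k: "k < n" using Suc.hyps(2) by simp
  have "card ((*\<^sub>v) P ` carrier_vec k) < card (carrier_vec n :: 'a vec set)"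
    unfolding card_range_full_col_rank[OF P] card_carrier_vec
    using k card_field_gt_1[where 'a = 'a] by (simp add: power_strict_increasing)
  then have "\<not> carrier_vec n \<subseteq> (*\<^sub>v) P ` carrier_vec k"
    by (meson card_mono finite_carrier_vec finite_imageI leD)
  then obtain v where v: "v \<in> carrier_vec n" "v \<notin> (*\<^sub>v) P ` carrier_vec k" by blast
  have R: "full_col_rank (append_col P v)"
    using full_col_rank_append_col_iff[OF P(1) v(1)] P(2) v(2) by simp
  have d: "d = n - Suc k" using Suc.hyps(2) by simp
  obtain g where g: "g \<in> carrier_mat n n" "full_col_rank g" "first_cols (Suc k) g = append_col P v"
    using Suc.hyps(1)[OF d append_col_carrier[OF P(1)] R] k by auto
  have "first_cols k g = P"
    using first_cols_first_cols[of k "Suc k" g] g(3) first_cols_append_col[OF P(1)] by simp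
  with g show ?case by blast
qed

lemma full_col_rank_first_cols:
  fixes g :: "'a::field mat"
  assumes g: "g \<in> carrier_mat n m" and R: "full_col_rank g" and k: "k \<le> m"
  shows "full_col_rank (first_cols k g)"
proof -
  have "x = 0\<^sub>v k" if x: "x \<in> carrier_vec k" and x0: "first_cols k g *\<^sub>v x = 0\<^sub>v n" for x
  proof -
    \<comment> \<open>a relation between the first columns is one between all columns, padded with zeros\<close>
    define y where "y = x @\<^sub>v 0\<^sub>v (m - k)"
    have y: "y \<in> carrier_vec m"
      using append_carrier_vec[OF x zero_carrier_vec[of "m - k"]] k by (simp add: y_def)
    have "g *\<^sub>v y = first_cols k g *\<^sub>v x"
    proof (rule eq_vecI)
      fix i assume "i < dim_vec (first_cols k g *\<^sub>v x)"
      then have i: "i < n" using g by (simp add: first_cols_def)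
      have "(\<Sum>j = 0..<m. g $$ (i, j) * y $ j) = (\<Sum>j = 0..<k. g $$ (i, j) * x $ j)"
        using k x by (intro sum.mono_neutral_cong_right) (auto simp: y_def)
      then show "(g *\<^sub>v y) $ i = (first_cols k g *\<^sub>v x) $ i"
        using i g x y by (simp add: scalar_prod_def first_cols_def)
    qed (use g in \<open>simp add: first_cols_def\<close>)
    with x0 have "y = 0\<^sub>v m" by (intro full_col_rankD[OF g R y]) simp
    then have "y $ i = 0" if "i < k" for i using that k by simp
    then show ?thesis using x k by (intro eq_vecI) (auto simp: y_def)
  qed
  then show ?thesis by (rule full_col_rankI[OF first_cols_carrier[OF g]])
qed

lemma full_col_rank_iff_invertible:
  fixes A :: "'a::field mat"
  assumes A: "A \<in> carrier_mat n n"
  shows "full_col_rank A \<longleftrightarrow> (\<exists>B \<in> carrier_mat n n. A * B = 1\<^sub>m n \<and> B * A = 1\<^sub>m n)"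
proof
  assume "full_col_rank A"
  then have "det A \<noteq> 0"
    using A unfolding det_0_iff_vec_prod_zero[OF A] full_col_rank_def by auto
  from det_non_zero_imp_unit[OF A this, of "()"]
  show "\<exists>B \<in> carrier_mat n n. A * B = 1\<^sub>m n \<and> B * A = 1\<^sub>m n"
    unfolding Units_def ring_mat_def by auto
next
  assume "\<exists>B \<in> carrier_mat n n. A * B = 1\<^sub>m n \<and> B * A = 1\<^sub>m n"
  then obtain B where B: "B \<in> carrier_mat n n" "B * A = 1\<^sub>m n" by blast
  have "x = 0\<^sub>v n" if x: "x \<in> carrier_vec n" and x0: "A *\<^sub>v x = 0\<^sub>v n" for x
  proof -
    have "x = (B * A) *\<^sub>v x" using B x by simp
    also have "\<dots> = B *\<^sub>v (A *\<^sub>v x)" by (rule assoc_mult_mat_vec[OF B(1) A x])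
    also have "\<dots> = 0\<^sub>v n" using x0 B by (auto intro!: eq_vecI)
    finally show ?thesis .
  qed
  then show "full_col_rank A" by (rule full_col_rankI[OF A])
qed

lemma full_col_rank_mult:
  fixes A :: "'a::field mat"
  assumes A: "A \<in> carrier_mat n m" "full_col_rank A" and B: "B \<in> carrier_mat m k" "full_col_rank B"
  shows "full_col_rank (A * B)"
  using assms by (auto simp: full_col_rank_def assoc_mult_mat_vec[OF A(1) B(1)])

definition general_linear :: "nat \<Rightarrow> 'a::field mat set" where
  "general_linear n = {A \<in> carrier_mat n n. full_col_rank A}"

lemma finite_general_linear: "finite (general_linear n :: 'a::{finite, field} mat set)"
  by (rule finite_subset[OF _ finite_carrier_mat]) (auto simp: general_linear_def)

lemma card_general_linear:
  "real (card (general_linear n :: 'a::{finite, field} mat set)) =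
   q_falling (real CARD('a)) (real CARD('a) ^ n) n"
proof -
  have "general_linear n = fixed_frames (1\<^sub>m n :: 'a mat) n"
    by (auto simp: general_linear_def fixed_frames_def)
  moreover have "fixed_space (1\<^sub>m n :: 'a mat) = carrier_vec n"
    by (auto simp: fixed_space_def)
  ultimately show ?thesis
    using card_fixed_frames[of "1\<^sub>m n :: 'a mat" n n] by (simp add: card_carrier_vec)
qed

text \<open>Orbit counting for a transitive action, as an explicit bijection. Fix for every tuple \<open>P\<close> an
  invertible \<open>G P\<close> that starts with the columns of \<open>P\<close>. If \<open>A\<close> fixes \<open>P\<close>, then \<open>A * G P\<close> starts with the
  columns of \<open>P\<close> again, so \<open>P\<close> and then \<open>A\<close> can be recovered from this product; and every invertible
  matrix arises in this way.\<close>
lemma sum_card_fixed_frames: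
  assumes k: "k \<le> n"
  shows "(\<Sum>A\<in>general_linear n. card (fixed_frames (A :: 'a::{finite, field} mat) k)) =
         card (general_linear n :: 'a mat set)"
proof -
  let ?GL = "general_linear n :: 'a mat set"
  have "\<exists>g h. g \<in> carrier_mat n n \<and> h \<in> carrier_mat n n \<and> g * h = 1\<^sub>m n \<and> h * g = 1\<^sub>m n
          \<and> first_cols k g = P"
    if "P \<in> carrier_mat n k" "full_col_rank P" for P :: "'a mat"
    using full_col_rank_extend[OF that k] full_col_rank_iff_invertible by blast
  then obtain G H :: "'a mat \<Rightarrow> 'a mat" where GH:
    "\<And>P. P \<in> carrier_mat n k \<Longrightarrow> full_col_rank P \<Longrightarrow>
       G P \<in> carrier_mat n n \<and> H P \<in> carrier_mat n n \<and> G P * H P = 1\<^sub>m n \<and> H P * G P = 1\<^sub>m n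
       \<and> first_cols k (G P) = P"
    by metis
  have rank: "full_col_rank (G P)" "full_col_rank (H P)"
    if "P \<in> carrier_mat n k" "full_col_rank P" for P
    using GH[OF that] full_col_rank_iff_invertible by blast+
  have "bij_betw (\<lambda>(A, P). A * G P) (SIGMA A : ?GL. fixed_frames A k) ?GL"
  proof (rule bij_betwI[where g = "\<lambda>g. (g * H (first_cols k g), first_cols k g)"])
    show "(\<lambda>(A, P). A * G P) \<in> (SIGMA A : ?GL. fixed_frames A k) \<rightarrow> ?GL"
      using GH rank by (auto simp: general_linear_def fixed_frames_def intro!: full_col_rank_mult)
    show "(\<lambda>g. (g * H (first_cols k g), first_cols k g)) \<in> ?GL \<rightarrow> (SIGMA A : ?GL. fixed_frames A k)"
    proof
      fix g assume "g \<in> ?GL"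
      then have g: "g \<in> carrier_mat n n" "full_col_rank g" by (auto simp: general_linear_def)
      define P where "P = first_cols k g"
      have P: "P \<in> carrier_mat n k" "full_col_rank P"
        using g full_col_rank_first_cols[OF g k] by (auto simp: P_def)
      note GHP = GH[OF P]
      have A: "g * H P \<in> ?GL"
        using g GHP rank[OF P] by (auto simp: general_linear_def intro!: full_col_rank_mult)
      have "g * H P * P = g * H P * first_cols k (G P)" using GHP by simp
      also have "\<dots> = first_cols k (g * H P * G P)"
        using mult_first_cols[of "g * H P" n "G P" n k] g GHP k by simp
      also have "g * H P * G P = g" using g GHP assoc_mult_mat[of g n n "H P" n "G P" n] by simp
      finally have "g * H P * P = P" by (simp add: P_def)
      with A P g have "(g * H P, P) \<in> (SIGMA A : ?GL. fixed_frames A k)"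
        by (auto simp: fixed_frames_def)
      then show "(g * H (first_cols k g), first_cols k g) \<in> (SIGMA A : ?GL. fixed_frames A k)"
        by (simp add: P_def)
    qed
  next
    fix AP assume "AP \<in> (SIGMA A : ?GL. fixed_frames A k)"
    then obtain A P where AP: "AP = (A, P)" and A: "A \<in> carrier_mat n n"
      and P: "P \<in> carrier_mat n k" "full_col_rank P" "A * P = P"
      by (auto simp: general_linear_def fixed_frames_def)
    note GHP = GH[OF P(1,2)]
    have "first_cols k (A * G P) = P"
      using mult_first_cols[OF A, of "G P" n k] GHP k P(3) by simp
    moreover have "A * G P * H P = A" using A GHP assoc_mult_mat[of A n n "G P" n "H P" n] by simp
    ultimately show "(\<lambda>g. (g * H (first_cols k g), first_cols k g)) (case AP of (A, P) \<Rightarrow> A * G P) = AP"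
      by (simp add: AP)
  next
    fix g assume "g \<in> ?GL"
    then have g: "g \<in> carrier_mat n n" "full_col_rank g" by (auto simp: general_linear_def)
    have P: "first_cols k g \<in> carrier_mat n k" "full_col_rank (first_cols k g)"
      using g full_col_rank_first_cols[OF g k] by auto
    show "(case (g * H (first_cols k g), first_cols k g) of (A, P) \<Rightarrow> A * G P) = g"
      using g GH[OF P] assoc_mult_mat[of g n n "H (first_cols k g)" n "G (first_cols k g)" n] by simp
  qed
  moreover have "card (SIGMA A : ?GL. fixed_frames A k) = (\<Sum>A\<in>?GL. card (fixed_frames A k))"
  proof (rule card_SigmaI[OF finite_general_linear], rule ballI)
    fix A :: "'a mat" show "finite (fixed_frames A k)"
      by (rule finite_subset[OF _ finite_carrier_mat]) (auto simp: fixed_frames_def)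
  qed
  ultimately show ?thesis by (simp add: bij_betw_same_card)
qed

section \<open>The number of linear derangements\<close>

text \<open>The weighted count of fixed tuples is the indicator of a trivial fixed space: \<open>i\<close> stands for the
  dimension of that space.\<close>
lemma sum_incl_excl_coeff_power:
  assumes q: "q > 1" and i: "i \<le> n"
  shows "(\<Sum>k\<le>n. incl_excl_coeff q k * q_falling q (q ^ i) k) = of_bool (i = 0)"
proof (cases i)
  case 0
  have "q_falling q 1 k = of_bool (k = 0)" for k
    unfolding q_falling_def using prod_zero[of "{..<k}" "\<lambda>i. 1 - q ^ i"] by (cases k) force+
  then have "(\<Sum>k\<le>n. incl_excl_coeff q k * q_falling q (q ^ i) k) =
      (\<Sum>k\<le>n. incl_excl_coeff q k * of_bool (k = 0))"
    using 0 by simp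
  also have "\<dots> = (\<Sum>k\<in>{0}. incl_excl_coeff q k * of_bool (k = 0))"
    by (rule sum.mono_neutral_right) auto
  finally show ?thesis using 0 by (simp add: incl_excl_coeff_def q_falling_def)
next
  case (Suc j)
  with i have "(\<Prod>l<n. q ^ i - q ^ Suc l) = 0" by (intro prod_zero) auto
  then show ?thesis using Suc by (simp add: sum_incl_excl_coeff[OF q])
qed

lemma linear_derangement_iff:
  fixes A :: "'a::{finite, field} mat"
  assumes A: "A \<in> carrier_mat n n"
  shows "linear_derangement A \<longleftrightarrow> full_col_rank A \<and> card (fixed_space A) = 1"
proof -
  have "invertible_mat A \<longleftrightarrow> full_col_rank A"
  proof
    assume "invertible_mat A"
    then obtain B where B: "A * B = 1\<^sub>m n" "B * A = 1\<^sub>m (dim_row B)"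
      using A unfolding invertible_mat_def inverts_mat_def by auto
    have "dim_col B = n" using arg_cong[OF B(1), of dim_col] by simp
    moreover have "dim_row B = n" using arg_cong[OF B(2), of dim_col] A by simp
    ultimately show "full_col_rank A"
      using B full_col_rank_iff_invertible[OF A] by (metis carrier_matI)
  next
    assume "full_col_rank A"
    then show "invertible_mat A"
      using A full_col_rank_iff_invertible[OF A]
      unfolding invertible_mat_def inverts_mat_def by (auto simp: square_mat.simps)
  qed
  moreover have "(\<forall>v \<in> carrier_vec n. A *\<^sub>v v = v \<longrightarrow> v = 0\<^sub>v n) \<longleftrightarrow> card (fixed_space A) = 1"
  proof -
    have 0: "0\<^sub>v n \<in> fixed_space A" using A by (auto simp: fixed_space_def)
    then have "(\<forall>v \<in> carrier_vec n. A *\<^sub>v v = v \<longrightarrow> v = 0\<^sub>v n) \<longleftrightarrow> fixed_space A = {0\<^sub>v n}"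
      using A by (auto simp: fixed_space_def)
    also have "\<dots> \<longleftrightarrow> card (fixed_space A) = 1"
      using 0 by (metis card_1_singletonE is_singletonI is_singleton_altdef singletonD)
    finally show ?thesis .
  qed
  ultimately show ?thesis using A unfolding linear_derangement_def by auto
qed

text \<open>Replace the indicator of a trivial fixed space by the weighted count of fixed tuples, exchange
  the two sums, and use that each inner sum is the order of the group. The convention for \<open>n = 0\<close>
  agrees with the formula.\<close>
lemma num_linear_derangements_eq_sum:
  "real (num_linear_derangements TYPE('a::{finite, field}) n) =
   q_falling (real CARD('a)) (real CARD('a) ^ n) n * (\<Sum>k\<le>n. incl_excl_coeff (real CARD('a)) k)"
proof (cases "n = 0")
  case True
  then show ?thesis by (simp add: num_linear_derangements_def incl_excl_coeff_def q_falling_def)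
next
  case False
  let ?GL = "general_linear n :: 'a mat set"
  define q where "q = real CARD('a)"
  have q: "q > 1" using card_field_gt_1[where 'a = 'a] by (simp add: q_def)
  have ind: "of_bool (card (fixed_space A) = 1) =
      (\<Sum>k\<le>n. incl_excl_coeff q k * real (card (fixed_frames A k)))" if "A \<in> ?GL" for A
  proof -
    have A: "A \<in> carrier_mat n n" using that by (simp add: general_linear_def)
    obtain i where i: "i \<le> n" "card (fixed_space A) = CARD('a) ^ i"
      using card_fixed_space_power[OF A] .
    have "card (fixed_space A) = 1 \<longleftrightarrow> i = 0"
      using i(2) card_field_gt_1[where 'a = 'a] by (cases i) auto
    then show ?thesis
      using sum_incl_excl_coeff_power[OF q i(1)] i(2) by (simp add: card_fixed_frames[OF A] q_def)
  qed
  have "{A :: 'a mat. A \<in> carrier_mat n n \<and> linear_derangement A} =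
        {A \<in> ?GL. card (fixed_space A) = 1}"
    using linear_derangement_iff by (auto simp: general_linear_def)
  then have "real (num_linear_derangements TYPE('a) n) = (\<Sum>A\<in>?GL. of_bool (card (fixed_space A) = 1))"
    using False finite_general_linear[where 'a = 'a and n = n]
    by (simp add: num_linear_derangements_def sum_of_bool_eq Int_def)
  also have "\<dots> = (\<Sum>A\<in>?GL. \<Sum>k\<le>n. incl_excl_coeff q k * real (card (fixed_frames A k)))"
    by (rule sum.cong[OF refl]) (rule ind)
  also have "\<dots> = (\<Sum>k\<le>n. incl_excl_coeff q k * real (\<Sum>A\<in>?GL. card (fixed_frames A k)))"
    by (subst sum.swap) (simp add: sum_distrib_left)
  also have "\<dots> = (\<Sum>k\<le>n. incl_excl_coeff q k * real (card ?GL))"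
    by (intro sum.cong refl) (simp only: sum_card_fixed_frames atMost_iff)
  also have "\<dots> = real (card ?GL) * (\<Sum>k\<le>n. incl_excl_coeff q k)"
    by (simp add: sum_distrib_left mult.commute)
  finally show ?thesis by (simp only: card_general_linear q_def)
qed

theorem corollary9:
  fixes q n :: nat
  assumes "primepow q"
    and "CARD('a::{finite, field}) = q"
    and "n \<ge> 1"
  shows "int (num_linear_derangements TYPE('a) n) =
           int (num_linear_derangements TYPE('a) (n - 1)) * (int q ^ n - 1) * int q ^ (n - 1)
           + (- 1) ^ n * int q ^ (n * (n - 1) div 2)"
proof -
  define r where "r = real q"
  have r: "r > 1" using card_field_gt_1[where 'a = 'a] assms(2) by (simp add: r_def)
  obtain m where n: "n = Suc m" using assms(3) by (cases n) auto
  define e where "e k = real (num_linear_derangements TYPE('a) k)" for k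
  define S where "S k = (\<Sum>i\<le>k. incl_excl_coeff r i)" for k
  have e: "e k = q_falling r (r ^ k) k * S k" for k
    using num_linear_derangements_eq_sum[where 'a = 'a and n = k] assms(2)
    by (simp add: e_def S_def r_def)
  have "e n = q_falling r (r ^ n) n * S m + q_falling r (r ^ n) n * incl_excl_coeff r n"
    by (simp add: e S_def n algebra_simps)
  also have "q_falling r (r ^ n) n * incl_excl_coeff r n = (- 1) ^ n * r ^ (n * (n - 1) div 2)"
    using q_falling_self_pos[OF r, of n] by (simp add: incl_excl_coeff_def)
  also have "q_falling r (r ^ n) n * S m = e m * (r ^ n - 1) * r ^ m"
    unfolding n q_falling_self_Suc by (simp add: e)
  finally have "e n = e m * (r ^ n - 1) * r ^ m + (- 1) ^ n * r ^ (n * (n - 1) div 2)" .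
  then have "real_of_int (int (num_linear_derangements TYPE('a) n)) =
    real_of_int (int (num_linear_derangements TYPE('a) (n - 1)) * (int q ^ n - 1) * int q ^ (n - 1)
           + (- 1) ^ n * int q ^ (n * (n - 1) div 2))"
    by (simp add: e_def r_def n del: power_Suc mult_Suc)
  then show ?thesis by (simp only: of_int_eq_iff)
qed

end
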